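(* Let $m\ge 1$ and let $G=(V,E)$ be an $m$-partite graph. Then $M(G)$ is the intersection of at most $m$ matroids on $E$.
   Context: Graphs are finite, undirected, without loops or multiple edges. A graph is $m$-partite if its vertex set can be partitioned into $m$ sets $V_1,\dots,V_m$ such that no edge has both endpoints in the same $V_i$. A matroid on a finite set $S$ is a family $\mathcal{M}$ of subsets of $S$ with $\emptyset\in\mathcal{M}$, closed under subsets, such that for every $A\subseteq S$ all maximal members of $\mathcal{M}$ contained in $A$ have the same cardinality. $M(G)$ denotes the family of all matchings of $G$ (sets of pairwise disjoint edges), viewed as a family of subsets of $E$. The intersection of matroids $\mathcal{M}_1,\dots,\mathcal{M}_k$ on $E$ is $\mathcal{M}_1\cap\dots\cap\mathcal{M}_k$. *)

theory Defs
  imports Main "HOL-Library.Disjoint_Sets"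
begin

definition simple_graph :: "'a set \<Rightarrow> 'a set set \<Rightarrow> bool" where
  "simple_graph V E \<longleftrightarrow> finite V \<and> (\<forall>e\<in>E. e \<subseteq> V \<and> card e = 2)"

text \<open>The parts are \<open>P 0, \<dots>, P (m - 1)\<close>; as usual for \<open>m\<close>-partite graphs, parts may be empty
  (which is why \<open>partition_on\<close> is not used).\<close>

definition multipartite :: "nat \<Rightarrow> 'a set \<Rightarrow> 'a set set \<Rightarrow> bool" where
  "multipartite m V E \<longleftrightarrow>
     (\<exists>P :: nat \<Rightarrow> 'a set. (\<Union>i<m. P i) = V \<and> disjoint_family_on P {..<m} \<and>
        (\<forall>e\<in>E. \<forall>i<m. \<not> e \<subseteq> P i))"

definition maximal_in :: "'b set set \<Rightarrow> 'b set \<Rightarrow> 'b set \<Rightarrow> bool" where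
  "maximal_in M A X \<longleftrightarrow> X \<in> M \<and> X \<subseteq> A \<and> (\<forall>Y\<in>M. Y \<subseteq> A \<longrightarrow> X \<subseteq> Y \<longrightarrow> Y = X)"

definition matroid :: "'b set \<Rightarrow> 'b set set \<Rightarrow> bool" where
  "matroid S M \<longleftrightarrow>
     finite S \<and> M \<subseteq> Pow S \<and> {} \<in> M \<and> (\<forall>X\<in>M. \<forall>Y. Y \<subseteq> X \<longrightarrow> Y \<in> M) \<and>
     (\<forall>A. A \<subseteq> S \<longrightarrow> (\<forall>X Y. maximal_in M A X \<longrightarrow> maximal_in M A Y \<longrightarrow> card X = card Y))"

definition matchings :: "'a set set \<Rightarrow> 'a set set set" where
  "matchings E = {F. F \<subseteq> E \<and> disjoint F}"

end

theory Submission
  imports Defs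
begin

text \<open>An edge meets each part \<open>P i\<close> in at most one vertex, so "no two edges share a vertex of
  \<open>P i\<close>" says that at most one edge is taken from each of a family of disjoint classes (the edges
  missing \<open>P i\<close> forming singleton classes). These are \<open>m\<close> partition matroids, and since the parts
  cover \<open>V\<close>, their intersection consists of the matchings.\<close>

lemma matroid_inj_on:
  assumes "finite S"
  shows "matroid S {F. F \<subseteq> S \<and> inj_on g F}"
proof -
  let ?M = "{F. F \<subseteq> S \<and> inj_on g F}"
  have card_max: "card X = card (g ` A)" if "A \<subseteq> S" and X: "maximal_in ?M A X" for A X
  proof -
    have "g a \<in> g ` X" if "a \<in> A" for a
    proof (rule ccontr)
      assume a: "g a \<notin> g ` X"
      have "insert a X \<in> ?M" "insert a X \<subseteq> A"
        using X a \<open>a \<in> A\<close> \<open>A \<subseteq> S\<close> by (auto simp: maximal_in_def)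
      then have "insert a X = X"
        using X unfolding maximal_in_def by blast
      then show False using a by blast
    qed
    then have "g ` X = g ` A"
      using X by (auto simp: maximal_in_def)
    moreover have "inj_on g X"
      using X by (auto simp: maximal_in_def)
    ultimately show ?thesis by (metis card_image)
  qed
  show ?thesis
    unfolding matroid_def
    using assms card_max by (auto intro: inj_on_subset)
qed

text \<open>Edges missing \<open>P\<close> serve as their own class label, which is no subset of \<open>P\<close>, hence distinct
  from the labels of the edges meeting \<open>P\<close>.\<close>

definition trace_class :: "'a set \<Rightarrow> 'a set \<Rightarrow> 'a set" where
  "trace_class P e = (if e \<inter> P = {} then e else e \<inter> P)"

lemma edge_Int_part:
  assumes "card e = 2" "\<not> e \<subseteq> P" "v \<in> e" "v \<in> P"
  shows "e \<inter> P = {v}"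
  using assms by (auto simp: card_2_iff)

text \<open>Equal labels of edges meeting \<open>P\<close> are a common nonempty trace. Conversely,
  a shared vertex in \<open>P\<close> is the whole trace of both edges, as neither edge lies inside
  \<open>P\<close>.\<close>

lemma trace_class_eq_iff:
  assumes "card e = 2" "card f = 2" "\<not> e \<subseteq> P" "\<not> f \<subseteq> P"
  shows "trace_class P e = trace_class P f \<longleftrightarrow> e = f \<or> e \<inter> f \<inter> P \<noteq> {}"
proof
  assume eq: "trace_class P e = trace_class P f"
  have "e \<noteq> {}" "f \<noteq> {}" using assms by auto
  with eq show "e = f \<or> e \<inter> f \<inter> P \<noteq> {}"
    by (auto simp: trace_class_def split: if_splits)
next
  assume "e = f \<or> e \<inter> f \<inter> P \<noteq> {}"
  then show "trace_class P e = trace_class P f"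
  proof
    assume "e \<inter> f \<inter> P \<noteq> {}"
    then obtain v where "v \<in> e" "v \<in> f" "v \<in> P" by blast
    then have "e \<inter> P = {v}" "f \<inter> P = {v}"
      using assms by (simp_all add: edge_Int_part)
    then show ?thesis by (simp add: trace_class_def)
  qed simp
qed

lemma matchings_eq_Inter:
  assumes "simple_graph V E" "I \<noteq> {}" "(\<Union>i\<in>I. P i) = V" "\<And>e i. e \<in> E \<Longrightarrow> i \<in> I \<Longrightarrow> \<not> e \<subseteq> P i"
  shows "matchings E = (\<Inter>i\<in>I. {F. F \<subseteq> E \<and> inj_on (trace_class (P i)) F})"
proof -
  have inj_iff: "inj_on (trace_class (P i)) F \<longleftrightarrow> (\<forall>e\<in>F. \<forall>f\<in>F. e \<noteq> f \<longrightarrow> e \<inter> f \<inter> P i = {})"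
    if "F \<subseteq> E" "i \<in> I" for F i
  proof -
    have "trace_class (P i) e = trace_class (P i) f \<longleftrightarrow> e = f \<or> e \<inter> f \<inter> P i \<noteq> {}"
      if "e \<in> F" "f \<in> F" for e f
      using that \<open>F \<subseteq> E\<close> \<open>i \<in> I\<close> assms
      by (intro trace_class_eq_iff) (auto simp: simple_graph_def)
    then show ?thesis unfolding inj_on_def by meson
  qed
  have "disjoint F \<longleftrightarrow> (\<forall>i\<in>I. inj_on (trace_class (P i)) F)" if "F \<subseteq> E" for F
  proof -
    have "e \<inter> f = {} \<longleftrightarrow> (\<forall>i\<in>I. e \<inter> f \<inter> P i = {})" if "e \<in> F" for e f
    proof -
      \<comment> \<open>By the covering, any vertex common to \<open>e\<close> and \<open>f\<close>
        lies in some part.\<close>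
      have "e \<subseteq> (\<Union>i\<in>I. P i)"
        using that \<open>F \<subseteq> E\<close> assms by (auto simp: simple_graph_def)
      then show ?thesis by blast
    qed
    then show ?thesis
      using inj_iff[OF \<open>F \<subseteq> E\<close>] by (simp add: disjoint_def) blast
  qed
  \<comment> \<open>With \<open>I\<close> nonempty, membership in the intersection forces
    \<open>F \<subseteq> E\<close>; an empty intersection would be \<open>UNIV\<close>.\<close>
  then show ?thesis
    using \<open>I \<noteq> {}\<close> by (auto simp: matchings_def)
qed

theorem theorem1:
  fixes m :: nat and V :: "'a set" and E :: "'a set set"
  assumes "m \<ge> 1"
    and "simple_graph V E"
    and "multipartite m V E"
  shows "\<exists>k \<M>. 1 \<le> k \<and> k \<le> m \<and> (\<forall>i\<in>{1..k}. matroid E (\<M> i)) \<and>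
           matchings E = (\<Inter>i\<in>{1..k::nat}. \<M> i)"
proof -
  obtain P where P: "(\<Union>i<m. P i) = V" "\<And>e i. e \<in> E \<Longrightarrow> i < m \<Longrightarrow> \<not> e \<subseteq> P i"
    using assms(3) unfolding multipartite_def by blast
  \<comment> \<open>Parts are numbered from 0, matroids from 1, hence the shift.\<close>
  define Q where "Q i = P (i - 1)" for i
  have cover: "(\<Union>i\<in>{1..m}. Q i) = V"
  proof -
    have "P i \<subseteq> (\<Union>j\<in>{1..m}. Q j)" if "i < m" for i
    proof -
      have "P i = Q (Suc i)" "Suc i \<in> {1..m}" using that by (auto simp: Q_def)
      then show ?thesis by blast
    qed
    moreover have "Q j \<subseteq> (\<Union>i<m. P i)" if "j \<in> {1..m}" for j
      using that unfolding Q_def by (intro UN_upper) auto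
    ultimately show ?thesis using P(1) by blast
  qed
  have "E \<subseteq> Pow V" "finite V"
    using assms(2) by (auto simp: simple_graph_def)
  then have "finite E"
    by (meson finite_Pow_iff finite_subset)
  moreover have "matchings E = (\<Inter>i\<in>{1..m}. {F. F \<subseteq> E \<and> inj_on (trace_class (Q i)) F})"
  proof (rule matchings_eq_Inter[OF assms(2) _ cover])
    show "\<not> e \<subseteq> Q i" if "e \<in> E" "i \<in> {1..m}" for e i
      using that P(2)[of e "i - 1"] by (simp add: Q_def less_eq_Suc_le)
  qed (use assms(1) in simp)
  \<comment> \<open>Take \<open>k = m\<close>, one matroid per part; an empty part contributes all
    subsets of \<open>E\<close>.\<close>
  ultimately show ?thesis
    using assms(1) by (intro exI[of _ m] exI conjI ballI) (auto intro: matroid_inj_on)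
qed

end
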